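(* The function $x\mapsto m(x)$ has corners at the points $$\frac{9}{17},\ \frac{8}{15},\ \frac{7}{13},\ \frac{6}{11},\ \frac{5}{9},\ \frac{9}{16},\ \frac{4}{7},\ \frac{7}{12},\ \frac{10}{17},\ \frac{3}{5},\ \frac{11}{18},\ \frac{8}{13},\ \frac{5}{8},\ \frac{7}{11},\ \frac{9}{14},\ \frac{11}{17},\ \frac{2}{3}.$$
   Context: The median of a finite list of real numbers $\xi_1,\dots,\xi_N$ with increasing rearrangement $\xi_{i_1}\le\dots\le\xi_{i_N}$ is $\mathrm{med}(\xi_1,\dots,\xi_N)=\xi_{i_{(N+1)/2}}$ if $N$ is odd and $\frac12(\xi_{i_{N/2}}+\xi_{i_{N/2+1}})$ if $N$ is even (repetitions counted with multiplicity). For $0<x<1$, put $x_1=0$, $x_2=x$, $x_3=1$, and for $n\ge4$ let $x_n$ be the unique real number such that $$\frac{x_1+x_2+\dots+x_n}{n}=\mathrm{med}(x_1,\dots,x_{n-1}).$$ Put $m_n=\mathrm{med}(x_1,\dots,x_n)$ for $n\ge4$; the sequence $(m_n)_{n\ge4}$ is known to be monotone. The mean-median map is $m(x)=\lim_{n\to\infty}m_n$, provided this (finite) limit exists. A point $c\in(0,1)$ is a corner of $m$ if there is $\delta>0$ such that $m$ is defined and continuous on $(c-\delta,c+\delta)$, $m$ is affine on $(c-\delta,c]$ and affine on $[c,c+\delta)$, and the two slopes are different. *)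

theory Defs
  imports "HOL-Analysis.Analysis"
begin

text \<open>Positions in the sorted list are counted from 0, so the entry of rank k is at index k - 1.\<close>

definition med :: "real list \<Rightarrow> real" where
  "med xs = (let s = sort xs; N = length xs in
     if odd N then s ! ((N + 1) div 2 - 1)
     else (s ! (N div 2 - 1) + s ! (N div 2)) / 2)"

text \<open>The sequence is indexed from 1; the value at index 0 is never used.\<close>

fun mm_seq :: "real \<Rightarrow> nat \<Rightarrow> real" where
  "mm_seq x n =
     (if n \<le> 1 then 0
      else if n = 2 then x
      else if n = 3 then 1
      else (THE t. ((\<Sum>i = 1..<n. mm_seq x i) + t) / real n
                     = med (map (mm_seq x) [1..<n])))"

declare mm_seq.simps [simp del]

lemma mm_seq_init: "mm_seq x 1 = 0" "mm_seq x 2 = x" "mm_seq x 3 = 1"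
  by (simp_all add: mm_seq.simps)

lemma mm_seq_unique:
  fixes x :: real
  assumes "n \<ge> 4"
  shows "\<exists>!t. ((\<Sum>i = 1..<n. mm_seq x i) + t) / real n = med (map (mm_seq x) [1..<n])"
proof (rule ex1I)
  show "((\<Sum>i = 1..<n. mm_seq x i)
      + (real n * med (map (mm_seq x) [1..<n]) - (\<Sum>i = 1..<n. mm_seq x i))) / real n
      = med (map (mm_seq x) [1..<n])"
    using assms by simp
next
  fix t
  assume "((\<Sum>i = 1..<n. mm_seq x i) + t) / real n = med (map (mm_seq x) [1..<n])"
  with assms show "t = real n * med (map (mm_seq x) [1..<n]) - (\<Sum>i = 1..<n. mm_seq x i)"
    by (simp add: field_simps)
qed

lemma mm_seq_mean:
  assumes "n \<ge> 4"
  shows "(\<Sum>i = 1..n. mm_seq x i) / real n = med (map (mm_seq x) [1..<n])"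
proof -
  have "mm_seq x n = (THE t. ((\<Sum>i = 1..<n. mm_seq x i) + t) / real n
                     = med (map (mm_seq x) [1..<n]))"
    using assms by (subst mm_seq.simps) simp
  then have "((\<Sum>i = 1..<n. mm_seq x i) + mm_seq x n) / real n = med (map (mm_seq x) [1..<n])"
    using theI'[OF mm_seq_unique[OF assms, of x]] by simp
  moreover have "{1..n} = insert n {1..<n}"
    using assms by auto
  ultimately show ?thesis
    by (simp add: add.commute)
qed

definition mm_median :: "real \<Rightarrow> nat \<Rightarrow> real" where
  "mm_median x n = med (map (mm_seq x) [1..<n + 1])"

text \<open>The mean-median map is partial: \<open>mm_map\<close> is meaningful only on \<open>mm_domain\<close>.\<close>

definition mm_domain :: "real set" where
  "mm_domain = {x. 0 < x \<and> x < 1 \<and> convergent (mm_median x)}"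

definition mm_map :: "real \<Rightarrow> real" where
  "mm_map x = lim (mm_median x)"

definition affine_with_slope_on :: "real set \<Rightarrow> (real \<Rightarrow> real) \<Rightarrow> real \<Rightarrow> bool" where
  "affine_with_slope_on S f a \<longleftrightarrow> (\<exists>b. \<forall>t\<in>S. f t = a * t + b)"

definition mm_corner :: "real \<Rightarrow> bool" where
  "mm_corner c \<longleftrightarrow> 0 < c \<and> c < 1 \<and>
     (\<exists>\<delta>>0. {c - \<delta><..<c + \<delta>} \<subseteq> mm_domain \<and>
        continuous_on {c - \<delta><..<c + \<delta>} mm_map \<and>
        (\<exists>a a'. affine_with_slope_on {c - \<delta><..c} mm_map a \<and>
                affine_with_slope_on {c..<c + \<delta>} mm_map a' \<and> a \<noteq> a'))"

end

theory Submission
  imports Defs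
begin

text \<open>If two consecutive medians agree, then the next entry equals them and the sequence is constant from
  there on. Near a corner \<open>c\<close>, every entry is an affine function of the distance \<open>e\<close> from \<open>c\<close> on each
  side, and for small \<open>e \<ge> 0\<close> the order of finitely many such functions is the lexicographic order of
  value at \<open>c\<close> and slope. Hence the recursion can be run exactly on pairs of integers; on both sides of
  each \<open>c\<close> it reaches a repeated median, which gives the common limit at \<open>c\<close> and the two one-sided
  slopes.\<close>

subsection \<open>Medians\<close>

lemma med_odd:
  assumes "sort L = A @ v # B" "length A = length B"
  shows "med L = v"
proof -
  have "length L = length (sort L)" by simp
  then have "length L = 2 * length A + 1" unfolding assms(1) using assms(2) by simp
  with assms(1) show ?thesis by (simp add: med_def nth_append)
qed

lemma med_even:
  assumes "sort L = A @ u # v # B" "length A = length B"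
  shows "med L = (u + v) / 2"
proof -
  have "length L = length (sort L)" by simp
  then have "length L = 2 * length A + 2" unfolding assms(1) using assms(2) by simp
  with assms(1) show ?thesis by (simp add: med_def nth_append)
qed

text \<open>For odd length the middle entry gets doubled, so the two new middle entries coincide.
  For even length the average fits between the two middle entries and becomes the middle.\<close>

lemma med_append_med:
  assumes "L \<noteq> []"
  shows "med (L @ [med L]) = med L"
proof (cases "odd (length L)")
  case True
  then obtain k where k: "length L = 2 * k + 1" by (elim oddE)
  define A v B where "A = take k (sort L)" "v = sort L ! k" "B = drop (Suc k) (sort L)"
  have s: "sort L = A @ v # B"
    unfolding A_v_B_def by (rule id_take_nth_drop) (simp add: k)
  have l: "length A = length B" by (simp add: A_v_B_def k)
  have m: "med L = v" using s l by (rule med_odd)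
  have "sorted (A @ v # B)" using s by (metis sorted_sort)
  moreover have "mset (A @ v # B) = mset L" using s by (metis mset_sort)
  ultimately have "sort (L @ [v]) = A @ v # v # B"
    by (intro properties_for_sort) (auto simp: sorted_append)
  then show ?thesis using med_even[of "L @ [v]" A v v B] l by (simp add: m)
next
  case False
  then obtain k' where "length L = 2 * k'" by (auto elim: evenE)
  moreover from this assms obtain k where "k' = Suc k" by (cases k') auto
  ultimately have k: "length L = 2 * k + 2" by simp
  define A u v B where
    "A = take k (sort L)" "u = sort L ! k" "v = sort L ! Suc k" "B = drop (Suc (Suc k)) (sort L)"
  have "sort L = A @ u # drop (Suc k) (sort L)"
    unfolding A_u_v_B_def by (rule id_take_nth_drop) (simp add: k)
  also have "drop (Suc k) (sort L) = v # B"
    unfolding A_u_v_B_def by (rule Cons_nth_drop_Suc[symmetric]) (simp add: k)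
  finally have s: "sort L = A @ u # v # B" .
  have l: "length A = length B" by (simp add: A_u_v_B_def k)
  have m: "med L = (u + v) / 2" using s l by (rule med_even)
  have srt: "sorted (A @ u # v # B)" using s by (metis sorted_sort)
  have ms: "mset (A @ u # v # B) = mset L" using s by (metis mset_sort)
  have uv: "u \<le> (u + v) / 2" "(u + v) / 2 \<le> v" using srt by (auto simp: sorted_append)
  have "sort (L @ [(u + v) / 2]) = (A @ [u]) @ ((u + v) / 2) # (v # B)"
  proof (rule properties_for_sort)
    show "sorted ((A @ [u]) @ ((u + v) / 2) # (v # B))"
      using srt uv by (auto simp: sorted_append intro: order_trans)
  qed (simp flip: ms)
  from med_odd[OF this] l show ?thesis by (simp add: m)
qed

text \<open>The sorted list carries \<open>V\<close> from rank \<open>r\<close> on, followed only by entries \<open>\<ge> z\<close>: since the medians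
  increase and stay below \<open>z\<close>, neither the entries before \<open>V\<close> nor those after it have to be known.\<close>

definition window :: "real list \<Rightarrow> nat \<Rightarrow> real list \<Rightarrow> real \<Rightarrow> bool" where
  "window L r V z \<longleftrightarrow> (\<exists>A B. sort L = A @ V @ B \<and> length A = r \<and> (\<forall>b\<in>set B. z \<le> b))"

lemma window_odd_med:
  assumes "window L r (v # V) z" "length L = 2 * r + 1"
  shows "med L = v"
proof -
  obtain A B where s: "sort L = A @ v # (V @ B)" "length A = r"
    using assms(1) by (auto simp: window_def)
  have "length (A @ v # (V @ B)) = 2 * r + 1"
    using s(1) assms(2) by (metis length_sort)
  with s(2) show ?thesis by (intro med_odd[OF s(1)]) simp
qed

lemma window_even_med:
  assumes "window L r (u # v # V) z" "length L = 2 * r + 2"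
  shows "med L = (u + v) / 2"
proof -
  obtain A B where s: "sort L = A @ u # v # (V @ B)" "length A = r"
    using assms(1) by (auto simp: window_def)
  have "length (A @ u # v # (V @ B)) = 2 * r + 2"
    using s(1) assms(2) by (metis length_sort)
  with s(2) show ?thesis by (intro med_even[OF s(1)]) simp
qed

lemma window_tl:
  assumes "window L r (v # V) z"
  shows "window L (Suc r) V z"
proof -
  obtain A B where "sort L = A @ v # V @ B" "length A = r" "\<forall>b\<in>set B. z \<le> b"
    using assms by (auto simp: window_def)
  then have "sort L = (A @ [v]) @ V @ B \<and> length (A @ [v]) = Suc r \<and> (\<forall>b\<in>set B. z \<le> b)" by simp
  then show ?thesis unfolding window_def by blast
qed

text \<open>If \<open>y\<close> joins \<open>V\<close>, sortedness of \<open>v # V' @ [z]\<close>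
  fits \<open>V'\<close> between the lower part and the tail, so the concatenation is again the
  sorted list. If \<open>z \<le> y\<close>, only the unknown tail grows. Either way \<open>v\<close>
  keeps its rank \<open>r\<close>.\<close>

lemma window_append:
  assumes w: "window L r (v # V) z" and V': "sorted (v # V' @ [z])"
    and y: "mset V' = add_mset y (mset V) \<or> V' = V \<and> z \<le> y"
  shows "window (L @ [y]) r (v # V') z"
proof -
  obtain A B where s: "sort L = A @ v # V @ B" and A: "length A = r" and B: "\<forall>b\<in>set B. z \<le> b"
    using w by (auto simp: window_def)
  have srt: "sorted (A @ v # V @ B)" using s by (metis sorted_sort)
  have ms: "mset L = mset (A @ v # V @ B)" using s by (metis mset_sort)
  have vz: "v \<le> z" "sorted V'" "\<forall>t\<in>set V'. v \<le> t \<and> t \<le> z"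
    using V' by (auto simp: sorted_append)
  show ?thesis using y
  proof
    assume y: "mset V' = add_mset y (mset V)"
    have "sort (L @ [y]) = A @ (v # V') @ B"
    proof (rule properties_for_sort)
      show "mset (A @ (v # V') @ B) = mset (L @ [y])" using ms y by simp
      show "sorted (A @ (v # V') @ B)"
        using srt vz B by (fastforce simp: sorted_append)
    qed
    with A B show ?thesis unfolding window_def by blast
  next
    assume y: "V' = V \<and> z \<le> y"
    have "sort (L @ [y]) = A @ (v # V) @ insort y B"
    proof (rule properties_for_sort)
      show "mset (A @ (v # V) @ insort y B) = mset (L @ [y])" using ms by simp
      show "sorted (A @ (v # V) @ insort y B)"
        using srt vz y by (fastforce simp: sorted_append sorted_insort set_insort_key)
    qed
    moreover have "\<forall>b\<in>set (insort y B). z \<le> b" using B y by (auto simp: set_insort_key)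
    ultimately show ?thesis using A y unfolding window_def by blast
  qed
qed

subsection \<open>The mean-median recursion\<close>

definition mm_list :: "real \<Rightarrow> nat \<Rightarrow> real list" where
  "mm_list x n = map (mm_seq x) [1..<n + 1]"

lemma mm_median_eq_med: "mm_median x n = med (mm_list x n)"
  by (simp add: mm_median_def mm_list_def)

lemma length_mm_list [simp]: "length (mm_list x n) = n"
  by (simp add: mm_list_def)

lemma mm_list_Suc: "mm_list x (Suc n) = mm_list x n @ [mm_seq x (Suc n)]"
  by (simp add: mm_list_def)

lemma mm_list_3: "mm_list x 3 = [0, x, 1]"
proof -
  have "[1..<3 + 1] = [1::nat, 2, 3]" by (simp add: upt_rec)
  then show ?thesis by (simp add: mm_list_def mm_seq_init mm_seq_init(1)[simplified])
qed

lemma sum_mm_seq: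
  assumes "n \<ge> 3"
  shows "(\<Sum>i = 1..Suc n. mm_seq x i) = real (Suc n) * mm_median x n"
  using mm_seq_mean[of "Suc n" x] assms by (simp add: mm_median_def field_simps del: sum.cl_ivl_Suc)

text \<open>The first \<open>n + 2\<close> entries sum to \<open>n + 2\<close> times the median of
  the first \<open>n + 1\<close>, and likewise one index lower; subtract.\<close>

lemma mm_seq_rec:
  assumes "n \<ge> 3"
  shows "mm_seq x (n + 2) = mm_median x (n + 1) + real (n + 1) * (mm_median x (n + 1) - mm_median x n)"
proof -
  have "(\<Sum>i = 1..Suc (Suc n). mm_seq x i) = (\<Sum>i = 1..Suc n. mm_seq x i) + mm_seq x (n + 2)"
    by simp
  then show ?thesis
    using sum_mm_seq[of n x] sum_mm_seq[of "Suc n" x] assms by (simp add: algebra_simps del: sum.cl_ivl_Suc)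
qed

text \<open>\<open>mm_seq_rec\<close> starts with entry 5, so entry 4 is obtained directly from its
  mean and the median \<open>x\<close> of \<open>0, x, 1\<close>.\<close>

lemma mm_seq_4:
  assumes "0 \<le> x" "x \<le> 1"
  shows "mm_seq x 4 = 3 * x - 1"
proof -
  have "mm_median x 3 = x"
    unfolding mm_median_eq_med mm_list_3 using assms by (intro med_odd[of _ "[0]" _ "[1]"]) auto
  moreover have "(\<Sum>i = 1..Suc 3. mm_seq x i) = 0 + x + 1 + mm_seq x 4"
    using mm_seq_init[of x] by (simp add: numeral_eq_Suc)
  ultimately show ?thesis using sum_mm_seq[of 3 x] by simp
qed

lemma mm_median_tendsto_if_repeated:
  assumes "n \<ge> 3" "mm_median x (n + 1) = mm_median x n"
  shows "mm_median x \<longlonglongrightarrow> mm_median x n"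
proof -
  \<comment> \<open>Two equalities are carried along because \<open>mm_seq_rec\<close> involves two
    consecutive medians.\<close>
  have "mm_median x (n + j + 1) = mm_median x n \<and> mm_median x (n + j) = mm_median x n" for j
  proof (induction j)
    case 0
    then show ?case using assms by simp
  next
    case (Suc j)
    then have "mm_seq x (n + j + 2) = mm_median x (n + j + 1)"
      using mm_seq_rec[of "n + j" x] assms(1) by simp
    then have "mm_list x (n + j + 2) = mm_list x (n + j + 1) @ [med (mm_list x (n + j + 1))]"
      using mm_list_Suc[of x "n + j + 1"] by (simp add: mm_median_eq_med)
    then have "mm_median x (n + j + 2) = mm_median x (n + j + 1)"
      unfolding mm_median_eq_med by (simp only:) (rule med_append_med, simp flip: length_0_conv)
    with Suc show ?case by simp
  qed
  then have "\<forall>k\<ge>n. mm_median x k = mm_median x n"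
    by (metis le_add_diff_inverse)
  then show ?thesis
    by (intro tendsto_eventually) (unfold eventually_sequentially, blast)
qed

subsection \<open>Germs\<close>

text \<open>At \<open>c + \<sigma> e\<close> with small \<open>e \<ge> 0\<close>, where \<open>\<sigma> = \<plusminus>1\<close>, every entry of the sequence has the form
  \<open>((A + a) + (B + b) * e) / D\<close> with integers \<open>a\<close>, \<open>b\<close> and is stored as the pair \<open>(a, b)\<close>; here
  \<open>(A + B * e) / D\<close> is the limit.\<close>

definition germ_value :: "int \<Rightarrow> int \<Rightarrow> int \<Rightarrow> real \<Rightarrow> int \<times> int \<Rightarrow> real" where
  "germ_value D A B e p = (of_int (A + fst p) + of_int (B + snd p) * e) / of_int D"

fun lex_le :: "int \<times> int \<Rightarrow> int \<times> int \<Rightarrow> bool" where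
  "lex_le (a, b) (c, d) \<longleftrightarrow> (if a = c then b \<le> d else a < c)"

fun lex_insert :: "int \<times> int \<Rightarrow> (int \<times> int) list \<Rightarrow> (int \<times> int) list" where
  "lex_insert p [] = [p]"
| "lex_insert p (q # qs) = (if lex_le p q then p # q # qs else q # lex_insert p qs)"

text \<open>Entries above the limit \<open>(0, 0)\<close> never become medians and are dropped.\<close>

definition cut_insert :: "int \<times> int \<Rightarrow> (int \<times> int) list \<Rightarrow> (int \<times> int) list" where
  "cut_insert p qs = (if lex_le p (0, 0) then lex_insert p qs else qs)"

text \<open>\<open>None\<close> signals that the midpoint is not integral; a suitable denominator
  \<open>D\<close> prevents this.\<close>

fun germ_mid :: "int \<times> int \<Rightarrow> int \<times> int \<Rightarrow> (int \<times> int) option" where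
  "germ_mid (a, b) (c, d) = (if even (a + c) \<and> even (b + d)
     then Some ((a + c) div 2, (b + d) div 2) else None)"

text \<open>This is \<open>mm_seq_rec\<close> on pairs, with \<open>n\<close> the index of the later
  median. Its coefficients \<open>1 + n\<close> and \<open>- n\<close> sum to 1, so subtracting the
  limit from all entries leaves its form unchanged.\<close>

fun extrapolate :: "int \<Rightarrow> int \<times> int \<Rightarrow> int \<times> int \<Rightarrow> int \<times> int" where
  "extrapolate n (a, b) (c, d) = (c + n * (c - a), d + n * (d - b))"

text \<open>For odd \<open>n\<close>, \<open>m\<close> is the median of the first \<open>n\<close> entries, \<open>U\<close> lists the entries from there up to
  the limit, and \<open>y\<close> is the next entry; two entries are appended per round, until the median repeats.\<close>

partial_function (option) median_germ ::
    "int \<Rightarrow> int \<times> int \<Rightarrow> int \<times> int \<Rightarrow> (int \<times> int) list \<Rightarrow> (int \<times> int) option" where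
  "median_germ n y m U =
     (if \<not> lex_le m y then None else
      case cut_insert y U of [] \<Rightarrow> None | h # T \<Rightarrow>
      (case germ_mid m h of None \<Rightarrow> None | Some e \<Rightarrow>
         if e = m then Some m
         else if \<not> lex_le m (extrapolate (n + 1) m e) then None else
         (case cut_insert (extrapolate (n + 1) m e) (h # T) of [] \<Rightarrow> None | h' # T' \<Rightarrow>
            if h' = e then Some e
            else median_germ (n + 2) (extrapolate (n + 2) e h') h' T')))"

abbreviation lex_sorted :: "(int \<times> int) list \<Rightarrow> bool" where
  "lex_sorted \<equiv> sorted_wrt lex_le"

section \<open>Order and arithmetic of integer pairs\<close>

lemma lex_le_trans: "lex_le p q \<Longrightarrow> lex_le q r \<Longrightarrow> lex_le p r"
  by (cases p; cases q; cases r) (auto split: if_splits)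

lemma lex_le_linear: "lex_le p q \<or> lex_le q p"
  by (cases p; cases q) auto

lemma set_lex_insert: "set (lex_insert p qs) = insert p (set qs)"
  by (induction qs) auto

lemma mset_lex_insert: "mset (lex_insert p qs) = add_mset p (mset qs)"
  by (induction qs) auto

lemma lex_sorted_insert: "lex_sorted qs \<Longrightarrow> lex_sorted (lex_insert p qs)"
proof (induction qs)
  case (Cons q qs)
  then show ?case
    using lex_le_linear[of p q] by (auto simp: set_lex_insert intro: lex_le_trans)
qed simp

lemma lex_sorted_cut_insert:
  assumes "lex_sorted (m # U @ [(0, 0)])" "lex_le m y"
  shows "lex_sorted (m # cut_insert y U @ [(0, 0)])"
  using assms lex_sorted_insert[of U y]
  by (auto simp: cut_insert_def sorted_wrt_append set_lex_insert)

text \<open>These are the two alternatives that \<open>window_append\<close> allows for a new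
  entry.\<close>

lemma cut_insert_cases:
  "mset (cut_insert y U) = add_mset y (mset U) \<or> cut_insert y U = U \<and> lex_le (0, 0) y"
  using lex_le_linear[of y "(0, 0)"] by (auto simp: cut_insert_def mset_lex_insert)

lemma germ_value_germ_mid:
  assumes "germ_mid p q = Some r"
  shows "germ_value D A B e r = (germ_value D A B e p + germ_value D A B e q) / 2"
proof -
  obtain a b c d where pq [simp]: "p = (a, b)" "q = (c, d)" by (cases p; cases q)
  have r: "r = ((a + c) div 2, (b + d) div 2)" and ev: "even (a + c)" "even (b + d)"
    using assms by (auto split: if_splits)
  have num: "real_of_int (A + fst r) = (of_int (A + a) + of_int (A + c)) / 2"
    "real_of_int (B + snd r) = (of_int (B + b) + of_int (B + d)) / 2"
    using ev by (auto simp: r real_of_int_div)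
  have "of_int (A + fst r) + of_int (B + snd r) * e
      = ((of_int (A + a) + of_int (B + b) * e) + (of_int (A + c) + of_int (B + d) * e)) / 2"
    unfolding num by (simp add: field_simps)
  then show ?thesis
    by (simp only: germ_value_def pq fst_conv snd_conv)
      (simp only: add_divide_distrib divide_divide_eq_left mult.commute)
qed

lemma germ_value_extrapolate:
  "germ_value D A B e (extrapolate n p q)
     = germ_value D A B e q + of_int n * (germ_value D A B e q - germ_value D A B e p)"
  by (cases p; cases q) (simp add: germ_value_def algebra_simps add_divide_distrib diff_divide_distrib)

text \<open>Unlike \<open>at_right 0\<close>, this filter includes the point 0, so the corner itself
  is covered from both sides.\<close>

definition right_nbhd :: "real filter" where
  "right_nbhd = inf (nhds 0) (principal {0..})"

lemma eventually_right_nbhd: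
  "eventually P right_nbhd \<longleftrightarrow> (\<exists>d>0. \<forall>e. 0 \<le> e \<and> e < d \<longrightarrow> P e)"
proof -
  have "(\<forall>e. dist e 0 < d \<longrightarrow> e \<in> {0..} \<longrightarrow> P e) \<longleftrightarrow> (\<forall>e. 0 \<le> e \<and> e < d \<longrightarrow> P e)" for d :: real
    by (auto simp: dist_real_def)
  then show ?thesis
    unfolding right_nbhd_def eventually_inf_principal eventually_nhds_metric by presburger
qed

text \<open>Equal constant terms leave the comparison to the slopes, as \<open>e \<ge> 0\<close>.
  Distinct ones are integers at least 1 apart, a gap that the slope terms cannot close for small
  \<open>e\<close>.\<close>

lemma eventually_germ_value_le:
  assumes "D > 0" "lex_le p q"
  shows "eventually (\<lambda>e. germ_value D A B e p \<le> germ_value D A B e q) right_nbhd"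
proof -
  obtain a b c d where [simp]: "p = (a, b)" "q = (c, d)" by (cases p; cases q)
  show ?thesis
  proof (cases "a = c")
    case True
    with assms have "b \<le> d" by simp
    with True assms(1) show ?thesis
      unfolding eventually_right_nbhd
      by (intro exI[of _ 1]) (auto simp: germ_value_def divide_right_mono mult_right_mono)
  next
    case False
    \<comment> \<open>The summand 1 keeps the denominator nonzero, and so the radius positive, when
      the slopes agree.\<close>
    define r where "r = 1 / (\<bar>of_int (b - d)\<bar> + 1 :: real)"
    have "germ_value D A B e p \<le> germ_value D A B e q" if e: "0 \<le> e" "e < r" for e
    proof -
      have "of_int (b - d) * e \<le> (\<bar>of_int (b - d)\<bar> + 1) * e"
        using e by (intro mult_right_mono) auto
      also have "\<dots> \<le> (\<bar>of_int (b - d)\<bar> + 1) * r"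
        using e by (intro mult_left_mono) auto
      also have "\<dots> = 1" by (simp add: r_def)
      also have "\<dots> \<le> of_int (c - a)" using False assms(2) by (simp del: of_int_diff)
      finally show ?thesis
        using assms(1) by (simp add: germ_value_def divide_right_mono algebra_simps)
    qed
    moreover have "r > 0" by (simp add: r_def add_nonneg_pos)
    ultimately show ?thesis unfolding eventually_right_nbhd by blast
  qed
qed

lemma eventually_sorted_germ_values:
  assumes "D > 0" "lex_sorted ps"
  shows "eventually (\<lambda>e. sorted (map (germ_value D A B e) ps)) right_nbhd"
  using assms(2)
proof (induction ps)
  case (Cons p ps)
  have "eventually (\<lambda>e. \<forall>q\<in>set ps. germ_value D A B e p \<le> germ_value D A B e q) right_nbhd"
    using Cons.prems assms(1) by (intro eventually_ball_finite ballI eventually_germ_value_le) auto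
  moreover have "eventually (\<lambda>e. sorted (map (germ_value D A B e) ps)) right_nbhd"
    using Cons by simp
  ultimately show ?case by eventually_elim simp
qed simp

section \<open>Running the recursion on germs\<close>

lemma eventually_window_append:
  assumes "D > 0" and srt: "lex_sorted (m # U @ [(0, 0)])" "lex_le m y"
    and w: "eventually (\<lambda>e. window (L e) r (map (germ_value D A B e) (m # U)) (germ_value D A B e (0, 0))) right_nbhd"
  shows "eventually (\<lambda>e. window (L e @ [germ_value D A B e y]) r
    (map (germ_value D A B e) (m # cut_insert y U)) (germ_value D A B e (0, 0))) right_nbhd"
proof -
  note v = cut_insert_cases[of y U]
  have "eventually (\<lambda>e. lex_le (0, 0) y \<longrightarrow> germ_value D A B e (0, 0) \<le> germ_value D A B e y) right_nbhd"
    using eventually_germ_value_le[OF assms(1), of "(0, 0)" y] by (cases "lex_le (0, 0) y") auto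
  moreover have "eventually (\<lambda>e. sorted (map (germ_value D A B e) (m # cut_insert y U @ [(0, 0)]))) right_nbhd"
    using srt by (intro eventually_sorted_germ_values assms(1) lex_sorted_cut_insert)
  ultimately show ?thesis
    using w
  proof eventually_elim
    case (elim e)
    have "mset (map (germ_value D A B e) (cut_insert y U))
        = add_mset (germ_value D A B e y) (mset (map (germ_value D A B e) U)) \<or>
      map (germ_value D A B e) (cut_insert y U) = map (germ_value D A B e) U \<and>
        germ_value D A B e (0, 0) \<le> germ_value D A B e y"
      using v elim(1) by auto
    then show ?case
      using window_append[of "L e" r "germ_value D A B e m"] elim(2,3) by simp
  qed
qed

text \<open>Induction over a run that returns \<open>Some r\<close>. Its invariant:
  \<open>m # U\<close> is the window from the middle rank \<open>k\<close> of the first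
  \<open>2 * k + 1\<close> entries, and \<open>y\<close> is the next entry. The tests
  \<open>lex_le m y\<close> reject entries below the window, which would shift its rank.\<close>

lemma median_germ_sound:
  fixes x :: "real \<Rightarrow> real"
  assumes "D > 0" "median_germ n y m U = Some r"
    "n = 2 * int k + 1" "k \<ge> 1" "lex_sorted (m # U @ [(0, 0)])"
    "eventually (\<lambda>e. window (mm_list (x e) (2 * k + 1)) k (map (germ_value D A B e) (m # U))
      (germ_value D A B e (0, 0))) right_nbhd"
    "eventually (\<lambda>e. mm_seq (x e) (2 * k + 2) = germ_value D A B e y) right_nbhd"
  shows "eventually (\<lambda>e. mm_median (x e) \<longlonglongrightarrow> germ_value D A B e r) right_nbhd"
  using assms(3-)
proof (induction n y m U r arbitrary: k rule: median_germ.raw_induct)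
  case (1 rec n y m U r)
  note run = "1.hyps" and n = "1.prems"(1) and k = "1.prems"(2) and srt = "1.prems"(3)
    and win = "1.prems"(4) and nxt = "1.prems"(5)
  let ?v = "germ_value D A B"
  from run obtain h T where my: "lex_le m y" and hT: "cut_insert y U = h # T"
    by (auto split: if_splits list.splits)
  from run my hT obtain e where e: "germ_mid m h = Some e"
    by (auto split: option.splits)
  have srt1: "lex_sorted (m # (h # T) @ [(0, 0)])"
    using lex_sorted_cut_insert[OF srt my] hT by simp
  have win1: "eventually (\<lambda>t. window (mm_list (x t) (2 * k + 2)) k (map (?v t) (m # h # T)) (?v t (0, 0))) right_nbhd"
    using eventually_window_append[OF assms(1) srt my win] nxt
    by eventually_elim (use mm_list_Suc[of _ "2 * k + 1"] hT in simp)
  have med1: "eventually (\<lambda>t. mm_median (x t) (2 * k + 1) = ?v t m) right_nbhd"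
    using win by eventually_elim (simp add: mm_median_eq_med window_odd_med)
  have med2: "eventually (\<lambda>t. mm_median (x t) (2 * k + 2) = ?v t e) right_nbhd"
    using win1 by eventually_elim (simp add: mm_median_eq_med window_even_med germ_value_germ_mid[OF e])
  show ?case
  proof (cases "e = m")
    case True
    with run my hT e have "r = m" by simp
    show ?thesis using med1 med2
    proof eventually_elim
      case (elim t)
      then show ?case
        using mm_median_tendsto_if_repeated[of "2 * k + 1" "x t"] k True \<open>r = m\<close> by simp
    qed
  next
    case False
    define y' where "y' = extrapolate (n + 1) m e"
    from False run my hT e obtain h' T' where my': "lex_le m y'" and hT': "cut_insert y' (h # T) = h' # T'"
      by (auto simp: y'_def split: if_splits list.splits)
    have nxt1: "eventually (\<lambda>t. mm_seq (x t) (2 * k + 3) = ?v t y') right_nbhd"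
      using med1 med2
    proof eventually_elim
      case (elim t)
      then show ?case
        using mm_seq_rec[of "2 * k + 1" "x t"] k
        by (simp add: y'_def germ_value_extrapolate n numeral_3_eq_3 algebra_simps)
    qed
    have srt2: "lex_sorted (m # (h' # T') @ [(0, 0)])"
      using lex_sorted_cut_insert[OF srt1 my'] hT' by simp
    \<comment> \<open>With \<open>2 * k + 3\<close> entries the middle rank is \<open>k + 1\<close>,
      so the old median \<open>m\<close> leaves the window.\<close>
    have win2: "eventually (\<lambda>t. window (mm_list (x t) (2 * k + 3)) (Suc k) (map (?v t) (h' # T')) (?v t (0, 0))) right_nbhd"
      using eventually_window_append[OF assms(1) srt1 my' win1] nxt1
    proof eventually_elim
      case (elim t)
      then show ?case
        using mm_list_Suc[of "x t" "2 * k + 2"] hT'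
        by (intro window_tl) (simp add: numeral_3_eq_3)
    qed
    have med3: "eventually (\<lambda>t. mm_median (x t) (2 * k + 3) = ?v t h') right_nbhd"
      using win2 by eventually_elim (simp add: mm_median_eq_med window_odd_med)
    show ?thesis
    proof (cases "h' = e")
      case True
      with False run my hT e my' hT' have "r = e" by (simp add: y'_def)
      show ?thesis using med2 med3
      proof eventually_elim
        case (elim t)
        then show ?case
          using mm_median_tendsto_if_repeated[of "2 * k + 2" "x t"] k True \<open>r = e\<close>
          by (simp add: numeral_3_eq_3)
      qed
    next
      case neq: False
      with False run my hT e my' hT'
      have rec: "rec (n + 2) (extrapolate (n + 2) e h') h' T' = Some r" by (simp add: y'_def)
      have nxt2: "eventually (\<lambda>t. mm_seq (x t) (2 * Suc k + 2) = ?v t (extrapolate (n + 2) e h')) right_nbhd"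
        using med2 med3
      proof eventually_elim
        case (elim t)
        then show ?case
          using mm_seq_rec[of "2 * k + 2" "x t"] k
          by (simp add: germ_value_extrapolate n numeral_3_eq_3 algebra_simps)
      qed
      have "2 * k + 3 = 2 * Suc k + 1" by simp
      from "1.IH"[OF rec _ _ _ win2[unfolded this] nxt2] srt2 n show ?thesis by simp
    qed
  qed
qed (rule assms(2))

text \<open>\<open>s = \<plusminus>D\<close> selects the side of \<open>P / D\<close>.\<close>

definition germ_limit :: "int \<Rightarrow> int \<Rightarrow> int \<Rightarrow> int \<Rightarrow> int \<Rightarrow> bool" where
  "germ_limit D P s A B \<longleftrightarrow> lex_le (D - A, - B) (0, 0) \<and>
     median_germ 3 (3 * P - D - A, 3 * s - B) (P - A, s - B) [(D - A, - B)] = Some (0, 0)"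

text \<open>The run starts from \<open>0, x, 1\<close> with \<open>k = 1\<close>: the window is
  \<open>x, 1\<close> and the next entry is \<open>3 * x - 1\<close>, all with the proposed limit
  subtracted. Stopping at \<open>(0, 0)\<close> confirms that limit.\<close>

lemma germ_limit_sound:
  assumes "germ_limit D P s A B" "0 < P" "P < D"
  shows "eventually (\<lambda>e. mm_median ((of_int P + of_int s * e) / of_int D)
    \<longlonglongrightarrow> (of_int A + of_int B * e) / of_int D) right_nbhd"
proof -
  let ?x = "\<lambda>e. (of_int P + of_int s * e) / of_int D :: real" and ?v = "germ_value D A B"
  from assms have D: "D > 0" by simp
  \<comment> \<open>With offset 0 instead of the limit, \<open>0 \<le> x \<le> 1\<close> is itself a
    statement about sorted germs.\<close>
  have "eventually (\<lambda>e. sorted (map (germ_value D 0 0 e) [(0, 0), (P, s), (D, 0)])) right_nbhd"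
    using assms by (intro eventually_sorted_germ_values) auto
  then have x01: "eventually (\<lambda>e. 0 \<le> ?x e \<and> ?x e \<le> 1) right_nbhd"
    by eventually_elim (use D in \<open>simp add: germ_value_def\<close>)
  have vals: "?v e (P - A, s - B) = ?x e" "?v e (D - A, - B) = 1"
    "?v e (3 * P - D - A, 3 * s - B) = 3 * ?x e - 1" for e
    using D by (simp_all add: germ_value_def field_simps)
  have "eventually (\<lambda>e. sorted (map (?v e) [(D - A, - B), (0, 0)])) right_nbhd"
    using assms by (intro eventually_sorted_germ_values D) (auto simp: germ_limit_def split: if_splits)
  with x01 have win: "eventually (\<lambda>e. window (mm_list (?x e) (2 * 1 + 1)) 1
    (map (?v e) [(P - A, s - B), (D - A, - B)]) (?v e (0, 0))) right_nbhd"
  proof eventually_elim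
    case (elim e)
    have "sort (mm_list (?x e) 3) = [0] @ [?x e, 1] @ []"
      using elim by (simp add: mm_list_3)
    then show ?case
      unfolding window_def by (intro exI[of _ "[0]"] exI[of _ "[]"]) (simp add: vals)
  qed
  have nxt: "eventually (\<lambda>e. mm_seq (?x e) (2 * 1 + 2) = ?v e (3 * P - D - A, 3 * s - B)) right_nbhd"
    using x01 by eventually_elim (simp add: vals mm_seq_4)
  have "lex_sorted ((P - A, s - B) # [(D - A, - B)] @ [(0, 0)])"
    using assms by (auto simp: germ_limit_def intro: lex_le_trans)
  moreover have "median_germ 3 (3 * P - D - A, 3 * s - B) (P - A, s - B) [(D - A, - B)] = Some (0, 0)"
    using assms(1) unfolding germ_limit_def by blast
  ultimately have "eventually (\<lambda>e. mm_median (?x e) \<longlonglongrightarrow> ?v e (0, 0)) right_nbhd"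
    using win nxt
    by (intro median_germ_sound[OF D, where k = 1 and n = 3 and y = "(3 * P - D - A, 3 * s - B)"
        and m = "(P - A, s - B)" and U = "[(D - A, - B)]"]) simp_all
  then show ?thesis by (simp add: germ_value_def)
qed

text \<open>The one-sided slopes at \<open>P / D\<close> are \<open>B / D\<close> and \<open>- (B' / D)\<close>.\<close>

definition corner_certificate :: "int \<Rightarrow> int \<Rightarrow> int \<Rightarrow> int \<Rightarrow> int \<Rightarrow> bool" where
  "corner_certificate D P A B B' \<longleftrightarrow> 0 < P \<and> P < D \<and> B + B' \<noteq> 0 \<and>
     germ_limit D P D A B \<and> germ_limit D P (- D) A B'"

text \<open>On the left \<open>e\<close> is \<open>c - t\<close>, which reverses the sign of the
  slope; hence the slopes differ exactly when \<open>B + B'\<close> is nonzero.\<close>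

lemma mm_corner_if_certificate:
  assumes "corner_certificate D P A B B'"
  shows "mm_corner (of_int P / of_int D)"
proof -
  let ?c = "of_int P / of_int D :: real" and ?l = "of_int A / of_int D :: real"
  let ?a = "of_int B / of_int D :: real" and ?a' = "- (of_int B' / of_int D) :: real"
  from assms have D: "0 < P" "P < D" and B: "B + B' \<noteq> 0"
    and r: "germ_limit D P D A B" and l: "germ_limit D P (- D) A B'"
    by (auto simp: corner_certificate_def)
  have c: "0 < ?c" "?c < 1" using D by simp_all
  have "eventually (\<lambda>e. mm_median (?c + e) \<longlonglongrightarrow> ?l + ?a * e) right_nbhd"
    using germ_limit_sound[OF r D] by eventually_elim (use D in \<open>simp add: add_divide_distrib\<close>)
  then obtain d1 where d1: "d1 > 0" "\<And>e. 0 \<le> e \<Longrightarrow> e < d1 \<Longrightarrow> mm_median (?c + e) \<longlonglongrightarrow> ?l + ?a * e"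
    unfolding eventually_right_nbhd by blast
  have "eventually (\<lambda>e. mm_median (?c - e) \<longlonglongrightarrow> ?l - ?a' * e) right_nbhd"
    using germ_limit_sound[OF l D] by eventually_elim (use D in \<open>simp add: add_divide_distrib diff_divide_distrib\<close>)
  then obtain d2 where d2: "d2 > 0" "\<And>e. 0 \<le> e \<Longrightarrow> e < d2 \<Longrightarrow> mm_median (?c - e) \<longlonglongrightarrow> ?l - ?a' * e"
    unfolding eventually_right_nbhd by blast
  \<comment> \<open>The last two bounds keep the interval inside \<open>(0, 1)\<close>, as
    \<open>mm_domain\<close> requires.\<close>
  define d where "d = Min {d1, d2, ?c, 1 - ?c}"
  have d: "d > 0" "d \<le> d1" "d \<le> d2" "d \<le> ?c" "d \<le> 1 - ?c"
    using c d1(1) d2(1) by (auto simp: d_def)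
  have right: "mm_median t \<longlonglongrightarrow> ?a * t + (?l - ?a * ?c)" if "t \<in> {?c..<?c + d}" for t
    using d1(2)[of "t - ?c"] d that by (simp add: algebra_simps)
  have left: "mm_median t \<longlonglongrightarrow> ?a' * t + (?l - ?a' * ?c)" if "t \<in> {?c - d<..?c}" for t
    using d2(2)[of "?c - t"] d that by (simp add: algebra_simps)
  have rmap: "mm_map t = ?a * t + (?l - ?a * ?c)" if "t \<in> {?c..<?c + d}" for t
    using right[OF that] by (simp add: mm_map_def limI)
  have lmap: "mm_map t = ?a' * t + (?l - ?a' * ?c)" if "t \<in> {?c - d<..?c}" for t
    using left[OF that] by (simp add: mm_map_def limI)
  have dom: "{?c - d<..<?c + d} \<subseteq> mm_domain"
  proof
    fix t assume t: "t \<in> {?c - d<..<?c + d}"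
    then have "t \<in> {?c - d<..?c} \<or> t \<in> {?c..<?c + d}" by auto
    then have "convergent (mm_median t)" using left right by (auto simp: convergent_def)
    with t d show "t \<in> mm_domain" by (simp add: mm_domain_def)
  qed
  have cont: "continuous_on {?c - d<..<?c + d} mm_map"
  proof -
    \<comment> \<open>Both pieces take the value \<open>A / D\<close> at the corner, since the two
      germ limits share \<open>A\<close>.\<close>
    have "continuous_on {?c - d<..<?c + d}
        (\<lambda>t. if t \<le> ?c then ?a' * t + (?l - ?a' * ?c) else ?a * t + (?l - ?a * ?c))"
      by (intro continuous_on_cases_le continuous_intros) auto
    then show ?thesis
      by (rule continuous_on_eq) (use lmap rmap in auto)
  qed
  have "?a \<noteq> ?a'"
  proof
    assume "?a = ?a'"
    then have "real_of_int (B + B') = 0" using D by (simp add: field_simps)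
    with B show False by (simp only: of_int_eq_0_iff)
  qed
  then show ?thesis
    unfolding mm_corner_def affine_with_slope_on_def
    using c d(1) dom cont lmap rmap by metis
qed

subsection \<open>Certificates\<close>

text \<open>Branching by matching on the value of the test, instead of by \<open>if\<close>, makes \<open>code_simp\<close> several times
  faster.\<close>

definition lex_le_branch :: "bool \<Rightarrow> int \<Rightarrow> int \<Rightarrow> int \<Rightarrow> int \<Rightarrow> bool" where
  "lex_le_branch t a b c d = (if t then b \<le> d else a < c)"

definition lex_insert_branch ::
    "bool \<Rightarrow> int \<times> int \<Rightarrow> int \<times> int \<Rightarrow> (int \<times> int) list \<Rightarrow> (int \<times> int) list" where
  "lex_insert_branch t p q qs = (if t then p # q # qs else q # lex_insert p qs)"

definition cut_insert_branch :: "bool \<Rightarrow> int \<times> int \<Rightarrow> (int \<times> int) list \<Rightarrow> (int \<times> int) list" where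
  "cut_insert_branch t p qs = (if t then lex_insert p qs else qs)"

lemma branch_code [code]:
  "lex_le_branch True a b c d = (b \<le> d)"
  "lex_le_branch False a b c d = (a < c)"
  "lex_insert_branch True p q qs = p # q # qs"
  "lex_insert_branch False p q qs = q # lex_insert p qs"
  "cut_insert_branch True p qs = lex_insert p qs"
  "cut_insert_branch False p qs = qs"
  by (simp_all add: lex_le_branch_def lex_insert_branch_def cut_insert_branch_def)

lemma lex_le_code [code]: "lex_le (a, b) (c, d) = lex_le_branch (a = c) a b c d"
  by (simp add: lex_le_branch_def)

lemma lex_insert_code [code]:
  "lex_insert p [] = [p]"
  "lex_insert p (q # qs) = lex_insert_branch (lex_le p q) p q qs"
  by (simp_all add: lex_insert_branch_def)

lemma cut_insert_code [code]: "cut_insert p qs = cut_insert_branch (lex_le p (0, 0)) p qs"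
  by (simp add: cut_insert_def cut_insert_branch_def)

declare median_germ.simps [code]

text \<open>The constants come from running the recursion in exact rational arithmetic; \<open>D\<close> is a common denominator
  of all values and slopes that occur.\<close>

lemma mm_corner_9_17: "mm_corner (9/17)"
proof -
  have "corner_certificate 4352 2304 4352 20713208 20639224"
    by code_simp
  from mm_corner_if_certificate[OF this] show ?thesis by simp
qed

lemma mm_corner_8_15: "mm_corner (8/15)"
proof -
  have "corner_certificate 30720 16384 30720 76089600 75628800"
    by code_simp
  from mm_corner_if_certificate[OF this] show ?thesis by simp
qed

lemma mm_corner_7_13: "mm_corner (7/13)"
proof -
  have "corner_certificate 3328 1792 5104 44184102456 44191538040"
    by code_simp
  from mm_corner_if_certificate[OF this] show ?thesis by simp
qed

lemma mm_corner_6_11: "mm_corner (6/11)"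
proof -
  have "corner_certificate 720896 393216 1261568 49085192992 49097087776"
    by code_simp
  from mm_corner_if_certificate[OF this] show ?thesis by simp
qed

lemma mm_corner_5_9: "mm_corner (5/9)"
proof -
  have "corner_certificate 36864 20480 46080 299987712 300817152"
    by code_simp
  from mm_corner_if_certificate[OF this] show ?thesis by simp
qed

lemma mm_corner_9_16: "mm_corner (9/16)"
proof -
  have "corner_certificate 32 18 32 15808 15552"
    by code_simp
  from mm_corner_if_certificate[OF this] show ?thesis by simp
qed

lemma mm_corner_4_7: "mm_corner (4/7)"
proof -
  have "corner_certificate 1792 1024 2624 22627696 22510320"
    by code_simp
  from mm_corner_if_certificate[OF this] show ?thesis by simp
qed

lemma mm_corner_7_12: "mm_corner (7/12)"
proof -
  have "corner_certificate 48 28 48 10512 10224"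
    by code_simp
  from mm_corner_if_certificate[OF this] show ?thesis by simp
qed

lemma mm_corner_10_17: "mm_corner (10/17)"
proof -
  have "corner_certificate 1088 640 1984 6099063072 6094591392"
    by code_simp
  from mm_corner_if_certificate[OF this] show ?thesis by simp
qed

lemma mm_corner_3_5: "mm_corner (3/5)"
proof -
  have "corner_certificate 40960 24576 98304 20209615840 20234580960"
    by code_simp
  from mm_corner_if_certificate[OF this] show ?thesis by simp
qed

lemma mm_corner_11_18: "mm_corner (11/18)"
proof -
  have "corner_certificate 9216 5632 17664 26029529064 26050942440"
    by code_simp
  from mm_corner_if_certificate[OF this] show ?thesis by simp
qed

lemma mm_corner_8_13: "mm_corner (8/13)"
proof -
  \<comment> \<open>Here \<open>D\<close> is 13 times \<open>2 ^ 14\<close>, the power of two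
    absorbing the halvings; the slopes are about 9 * 10^12 in size.\<close>
  have "corner_certificate 212992 131072 663552 1976934725036595376 1976973954095786672"
    by code_simp
  from mm_corner_if_certificate[OF this] show ?thesis by simp
qed

lemma mm_corner_5_8: "mm_corner (5/8)"
proof -
  \<comment> \<open>Here \<open>B = B'\<close>: the two slopes are opposite, so the graph is locally
    symmetric about the corner.\<close>
  have "corner_certificate 64 40 136 1140912 1140912"
    by code_simp
  from mm_corner_if_certificate[OF this] show ?thesis by simp
qed

lemma mm_corner_7_11: "mm_corner (7/11)"
proof -
  have "corner_certificate 5632 3584 7424 17492640 17517984"
    by code_simp
  from mm_corner_if_certificate[OF this] show ?thesis by simp
qed

lemma mm_corner_9_14: "mm_corner (9/14)"
proof -
  have "corner_certificate 1792 1152 2944 17511256 17545304"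
    by code_simp
  from mm_corner_if_certificate[OF this] show ?thesis by simp
qed

lemma mm_corner_11_17: "mm_corner (11/17)"
proof -
  have "corner_certificate 557056 360448 1122304 6091754683872 6084283727328"
    by code_simp
  from mm_corner_if_certificate[OF this] show ?thesis by simp
qed

lemma mm_corner_2_3: "mm_corner (2/3)"
proof -
  have "corner_certificate 96 64 96 11088 10800"
    by code_simp
  from mm_corner_if_certificate[OF this] show ?thesis by simp
qed

theorem corollary1p4:
  "\<forall>c \<in> {9/17, 8/15, 7/13, 6/11, 5/9, 9/16, 4/7, 7/12, 10/17, 3/5, 11/18, 8/13,
           5/8, 7/11, 9/14, 11/17, 2/3 :: real}. mm_corner c"
  by (simp add: mm_corner_9_17 mm_corner_8_15 mm_corner_7_13 mm_corner_6_11 mm_corner_5_9 mm_corner_9_16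
    mm_corner_4_7 mm_corner_7_12 mm_corner_10_17 mm_corner_3_5 mm_corner_11_18 mm_corner_8_13
    mm_corner_5_8 mm_corner_7_11 mm_corner_9_14 mm_corner_11_17 mm_corner_2_3)

end
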